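(* A binary sequence $r_0r_1\cdots r_n$ is the ppr-sequence of some $n\times n$ nonnegative real matrix if and only if either (i) $r_0=0$ and $r_i=1$ for all $i=1,2,\dots,n$, or (ii) $r_0=1$.
   Context: The permanent of an $m\times m$ matrix is ${\rm per}(A)=\sum_{\sigma\in S_m}\prod_{i=1}^m a_{i\sigma(i)}$. The principal permanent rank characteristic sequence (ppr-sequence) of an $n\times n$ matrix $A$ is $r_0r_1\cdots r_n$ where, for $1\le k\le n$, $r_k=1$ iff $A$ has a principal submatrix of size $k$ with nonzero permanent (else $r_k=0$), and $r_0=1$ iff $A$ has a zero entry on its main diagonal.
   Formalization: The sequence 11 (n = 1) is excluded, because a 1×1 matrix has a zero on its diagonal exactly when its permanent vanishes, so 11 is not attained although r_0 = 1; also n ≥ 1 is assumed. *)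

theory Defs
  imports
    "Jordan_Normal_Form.DL_Submatrix"
    "HOL-Combinatorics.Permutations"
    Complex_Main
begin

text \<open>Only used for square matrices; the indices \<open>1..m\<close> become \<open>0..<m\<close>, as everywhere
  in the matrix library.\<close>

definition permanent :: "'a::comm_ring_1 mat \<Rightarrow> 'a" where
  "permanent A =
     (\<Sum>p\<in>{p. p permutes {0..<dim_row A}}. \<Prod>i = 0..<dim_row A. A $$ (i, p i))"

abbreviation principal_submatrix :: "'a mat \<Rightarrow> nat set \<Rightarrow> 'a mat" where
  "principal_submatrix A I \<equiv> submatrix A I I"

text \<open>The term \<open>r\<^sub>0\<close> records a zero on the main diagonal; it is not the
  permanent condition at size \<open>0\<close>.\<close>

definition ppr_term :: "'a::comm_ring_1 mat \<Rightarrow> nat \<Rightarrow> nat" where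
  "ppr_term A k =
     (if k = 0 then (if \<exists>i<dim_row A. A $$ (i, i) = 0 then 1 else 0)
      else (if \<exists>I. I \<subseteq> {0..<dim_row A} \<and> card I = k
                 \<and> permanent (principal_submatrix A I) \<noteq> 0 then 1 else 0))"

definition ppr_seq :: "'a::comm_ring_1 mat \<Rightarrow> nat list" where
  "ppr_seq A = map (ppr_term A) [0..<Suc (dim_row A)]"

definition nonneg_mat :: "real mat \<Rightarrow> bool" where
  "nonneg_mat A \<longleftrightarrow> (\<forall>i<dim_row A. \<forall>j<dim_col A. 0 \<le> A $$ (i, j))"

text \<open>A \<open>1 \<times> 1\<close> matrix has a zero on its diagonal exactly when its permanent vanishes, so
  \<open>11\<close> is not a ppr-sequence although it begins with \<open>1\<close>.\<close>

lemma ppr_seq_neq_11: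
  fixes A :: "real mat"
  assumes A: "A \<in> carrier_mat 1 1"
  shows "ppr_seq A \<noteq> [1, 1]"
proof
  assume seq: "ppr_seq A = [1, 1]"
  have dims: "dim_row A = 1" "dim_col A = 1" using A by auto
  have "ppr_seq A = [ppr_term A 0, ppr_term A 1]"
    by (simp add: ppr_seq_def dims)
  with seq have t0: "ppr_term A 0 = 1" and t1: "ppr_term A 1 = 1" by simp_all
  from t0 have "\<exists>i<dim_row A. A $$ (i, i) = 0"
    unfolding ppr_term_def by presburger
  then have z: "A $$ (0, 0) = 0" by (simp add: dims)
  from t1 obtain I where I: "I \<subseteq> {0..<dim_row A}" "card I = 1"
    and nz: "permanent (submatrix A I I) \<noteq> 0"
    unfolding ppr_term_def by (metis zero_neq_one)
  from I have I0: "I = {0}"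
    by (auto simp: dims card_1_singleton_iff)
  have d: "dim_row (submatrix A I I) = 1"
    by (simp add: dim_submatrix dims I0 cong: conj_cong)
  have p: "pick {0} 0 = 0"
    by (simp add: Least_equality)
  have "submatrix A I I $$ (0, 0) = 0"
    by (subst submatrix_index) (simp_all add: dims I0 z p cong: conj_cong)
  with nz show False
    by (simp add: permanent_def d)
qed

end

theory Submission
  imports Defs
begin

text \<open>
  For a nonnegative matrix, the principal minor of the permanent on \<open>I\<close> is nonzero iff the
  digraph of nonzero entries has a cycle cover of \<open>I\<close>. If the diagonal has no zero, the loops
  cover every \<open>I\<close>. Otherwise, take the digraph made of the path \<open>0 \<rightarrow> 1 \<rightarrow> \<dots> \<rightarrow> n - 1\<close>
  and a back edge \<open>k - 1 \<rightarrow> 0\<close> for every \<open>k\<close> with \<open>r\<^sub>k = 1\<close>: all its cycles run through \<open>0\<close>, so a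
  coverable \<open>I\<close> is the vertex set \<open>{0, \<dots>, k - 1}\<close> of a single cycle.
\<close>

text \<open>The index \<open>i\<close> is recovered from \<open>pick I i\<close> as the number of
  elements of \<open>I\<close> below it, which gives injectivity; counting gives the rest.\<close>

lemma bij_betw_pick:
  assumes "finite I"
  shows "bij_betw (pick I) {0..<card I} I"
proof -
  have "inj_on (pick I) {0..<card I}"
    by (rule inj_onI) (metis atLeastLessThan_iff card_pick)
  moreover have "pick I ` {0..<card I} \<subseteq> I"
    by (auto intro: pick_in_set)
  ultimately show ?thesis
    using assms by (simp add: bij_betw_def card_image card_subset_eq)
qed

text \<open>Conjugation by the enumeration \<open>pick I\<close> carries permutations of the indices
  of the submatrix to permutations of \<open>I\<close>, so that later arguments can work with
  entries of \<open>A\<close> itself.\<close>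

lemma permanent_principal_submatrix:
  assumes A: "A \<in> carrier_mat n n" and I: "I \<subseteq> {0..<n}"
  shows "permanent (principal_submatrix A I) = (\<Sum>p | p permutes I. \<Prod>i\<in>I. A $$ (i, p i))"
proof -
  define K where "K = {0..<card I}"
  have bij: "bij_betw (pick I) K I"
    unfolding K_def using I by (intro bij_betw_pick) (auto intro: finite_subset)
  have eq: "{i. i < n \<and> i \<in> I} = I"
    using I by auto
  have dim: "dim_row (principal_submatrix A I) = card I"
    using A eq by (simp add: dim_submatrix)
  \<comment> \<open>The conjugate of \<open>p\<close> by \<open>pick I\<close>, fixing everything
    outside \<open>I\<close>, in the shape that \<open>bij_betw_permutations\<close>
    provides.\<close>
  let ?g = "\<lambda>p x. if x \<in> I then pick I (p (inv_into K (pick I) x)) else x"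
  have "(\<Prod>i\<in>K. principal_submatrix A I $$ (i, p i)) = (\<Prod>i\<in>I. A $$ (i, ?g p i))"
    if p: "p permutes K" for p
  proof -
    have "(\<Prod>i\<in>K. principal_submatrix A I $$ (i, p i)) = (\<Prod>i\<in>K. A $$ (pick I i, ?g p (pick I i)))"
    proof (rule prod.cong[OF refl])
      fix i assume i: "i \<in> K"
      then have "p i \<in> K"
        using p by (simp add: permutes_in_image)
      with i have "principal_submatrix A I $$ (i, p i) = A $$ (pick I i, pick I (p i))"
        using A eq by (simp add: submatrix_index K_def)
      moreover have "pick I i \<in> I" "inv_into K (pick I) (pick I i) = i"
        using bij i by (auto simp: bij_betw_def)
      ultimately show "principal_submatrix A I $$ (i, p i) = A $$ (pick I i, ?g p (pick I i))"
        by simp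
    qed
    also have "\<dots> = (\<Prod>i\<in>I. A $$ (i, ?g p i))"
      by (rule prod.reindex_bij_betw[OF bij])
    finally show ?thesis .
  qed
  then have "permanent (principal_submatrix A I) = (\<Sum>p | p permutes K. \<Prod>i\<in>I. A $$ (i, ?g p i))"
    unfolding permanent_def dim K_def[symmetric] by (intro sum.cong) auto
  also have "\<dots> = (\<Sum>p | p permutes I. \<Prod>i\<in>I. A $$ (i, p i))"
    by (rule sum.reindex_bij_betw[OF bij_betw_permutations[OF bij]])
  finally show ?thesis .
qed

text \<open>With nonnegative entries no two terms of the permanent can cancel, so it vanishes only
  if every term does.\<close>

lemma permanent_principal_submatrix_nonzero_iff:
  assumes A: "A \<in> carrier_mat n n" "nonneg_mat A" and I: "I \<subseteq> {0..<n}"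
  shows "permanent (principal_submatrix A I) \<noteq> 0 \<longleftrightarrow>
    (\<exists>p. p permutes I \<and> (\<forall>i\<in>I. A $$ (i, p i) \<noteq> 0))"
proof -
  have fin: "finite I"
    using I finite_subset by blast
  have "0 \<le> (\<Prod>i\<in>I. A $$ (i, p i))" if "p permutes I" for p
  proof (rule prod_nonneg)
    fix i assume "i \<in> I"
    with that have "i < n" "p i < n"
      using I by (auto simp: subset_iff permutes_in_image)
    with A show "0 \<le> A $$ (i, p i)"
      by (auto simp: nonneg_mat_def)
  qed
  then have "permanent (principal_submatrix A I) = 0 \<longleftrightarrow>
      (\<forall>p\<in>{p. p permutes I}. (\<Prod>i\<in>I. A $$ (i, p i)) = 0)"
    unfolding permanent_principal_submatrix[OF A(1) I]
    by (intro sum_nonneg_eq_0_iff) (auto simp: fin finite_permutations)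
  then show ?thesis
    using fin by auto
qed

lemma ppr_term_eq_1_if_nonzero_diagonal:
  assumes A: "A \<in> carrier_mat n n" "nonneg_mat A"
    and diag: "\<And>i. i < n \<Longrightarrow> A $$ (i, i) \<noteq> 0" and k: "k \<in> {1..n}"
  shows "ppr_term A k = 1"
proof -
  have "permanent (principal_submatrix A {0..<k}) \<noteq> 0"
    using k diag permutes_id
    by (subst permanent_principal_submatrix_nonzero_iff[OF A]) fastforce+
  then have "\<exists>I. I \<subseteq> {0..<dim_row A} \<and> card I = k \<and> permanent (principal_submatrix A I) \<noteq> 0"
    using A(1) k by (intro exI[of _ "{0..<k}"]) auto
  then show ?thesis
    using k unfolding ppr_term_def by auto
qed

text \<open>The back edge from \<open>i\<close> closes a cycle on the \<open>i + 1\<close> vertices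
  \<open>0, ..., i\<close>, hence the index \<open>Suc i\<close> into \<open>r\<close>.\<close>

definition path_mat :: "nat \<Rightarrow> nat list \<Rightarrow> real mat" where
  "path_mat n r =
     mat n n (\<lambda>(i, j). if j = Suc i \<or> j = 0 \<and> r ! Suc i = 1 then 1 else 0)"

lemma path_mat_carrier: "path_mat n r \<in> carrier_mat n n"
  by (simp add: path_mat_def)

lemma nonneg_path_mat: "nonneg_mat (path_mat n r)"
  by (simp add: nonneg_mat_def path_mat_def)

lemma path_mat_nonzero_iff:
  assumes "i < n" "j < n"
  shows "path_mat n r $$ (i, j) \<noteq> 0 \<longleftrightarrow> j = Suc i \<or> j = 0 \<and> r ! Suc i = 1"
  using assms by (auto simp: path_mat_def)

text \<open>This is the cycle 0, 1, ..., \<open>m\<close>, 0 that covers \<open>{0..m}\<close>; for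
  \<open>m = 0\<close> it is a loop.\<close>

lemma rotation_permutes:
  "(\<lambda>i. if i < m then Suc i else if i = m then 0 else i) permutes {0..m}"
proof (rule bij_imp_permutes)
  let ?f = "\<lambda>i. if i < m then Suc i else if i = m then 0 else i"
  have "inj_on ?f {0..m}"
    by (auto simp: inj_on_def)
  moreover have "?f ` {0..m} \<subseteq> {0..m}"
    by auto
  ultimately show "bij_betw ?f {0..m} {0..m}"
    unfolding bij_betw_def by (metis endo_inj_surj finite_atLeastAtMost)
qed auto

lemma path_mat_cycle_cover_iff:
  assumes I: "I \<subseteq> {0..<n}" "I \<noteq> {}"
  shows "(\<exists>p. p permutes I \<and> (\<forall>i\<in>I. path_mat n r $$ (i, p i) \<noteq> 0)) \<longleftrightarrow>
    (\<exists>m. I = {0..m} \<and> r ! Suc m = 1)" (is "?L \<longleftrightarrow> ?R")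
proof
  assume ?L
  then obtain p where p: "p permutes I" and nz: "\<And>i. i \<in> I \<Longrightarrow> path_mat n r $$ (i, p i) \<noteq> 0"
    by blast
  have step: "p i = Suc i \<or> p i = 0 \<and> r ! Suc i = 1" if "i \<in> I" for i
  proof -
    have "i < n" "p i < n"
      using that I(1) p by (auto simp: subset_iff permutes_in_image)
    then show ?thesis
      using nz[OF that] by (simp add: path_mat_nonzero_iff)
  qed
  have fin: "finite I"
    using I(1) finite_subset by blast
  define m where "m = Max I"
  have m: "m \<in> I" "\<And>i. i \<in> I \<Longrightarrow> i \<le> m"
    using fin I(2) by (auto simp: m_def)
  have "p m \<in> I"
    using m(1) p by (simp add: permutes_in_image)
  \<comment> \<open>The path edge would lead from \<open>m\<close> out of \<open>I\<close>, above
    its maximum, so \<open>p\<close> takes the back edge at \<open>m\<close>.\<close>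
  with step[OF m(1)] m(2) have "r ! Suc m = 1"
    by (metis Suc_n_not_le_n)
  \<comment> \<open>A positive vertex can be entered only from its predecessor, and \<open>p\<close>
    maps onto \<open>I\<close>; hence \<open>I\<close> is closed downwards.\<close>
  have pred: "j \<in> I" if "Suc j \<in> I" for j
  proof -
    from that p obtain i where "i \<in> I" "p i = Suc j"
      by (metis image_iff permutes_image)
    with step[of i] show ?thesis
      by auto
  qed
  \<comment> \<open>Downward induction from \<open>m\<close>; truncated subtraction merely stays at
    0 once \<open>d\<close> exceeds \<open>m\<close>.\<close>
  have "m - d \<in> I" for d
  proof (induction d)
    case (Suc d)
    then show ?case
      by (cases "m - d") (auto simp: diff_Suc intro: pred)
  qed (simp add: m)
  then have "i \<in> I" if "i \<le> m" for i
    using that by (metis diff_diff_cancel)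
  with m(2) have "I = {0..m}"
    by auto
  with \<open>r ! Suc m = 1\<close> show ?R
    by blast
next
  assume ?R
  then obtain m where m: "I = {0..m}" "r ! Suc m = 1"
    by blast
  with I(1) have "m < n"
    by auto
  let ?f = "\<lambda>i. if i < m then Suc i else if i = m then 0 else i"
  have "path_mat n r $$ (i, ?f i) \<noteq> 0" if "i \<in> I" for i
    using that m \<open>m < n\<close> by (subst path_mat_nonzero_iff) auto
  with rotation_permutes[of m] m(1) show ?L
    by blast
qed

lemma ppr_term_path_mat:
  assumes k: "k \<in> {1..n}" and r: "r ! k \<in> {0, 1}"
  shows "ppr_term (path_mat n r) k = r ! k"
proof -
  have "(\<exists>I. I \<subseteq> {0..<n} \<and> card I = k \<and> permanent (principal_submatrix (path_mat n r) I) \<noteq> 0)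
    \<longleftrightarrow> (\<exists>I. I \<subseteq> {0..<n} \<and> card I = k \<and> (\<exists>m. I = {0..m} \<and> r ! Suc m = 1))"
  proof (intro ex_cong1 conj_cong refl)
    fix I assume I: "I \<subseteq> {0..<n}" "card I = k"
    \<comment> \<open>The empty set must be excluded, since it has the trivial cycle cover but is
      not of the form \<open>{0..m}\<close>.\<close>
    with k have "I \<noteq> {}"
      by auto
    with I(1) show "permanent (principal_submatrix (path_mat n r) I) \<noteq> 0 \<longleftrightarrow>
        (\<exists>m. I = {0..m} \<and> r ! Suc m = 1)"
      using path_mat_cycle_cover_iff
        permanent_principal_submatrix_nonzero_iff[OF path_mat_carrier nonneg_path_mat]
      by simp
  qed
  \<comment> \<open>Since \<open>{0..m}\<close> has \<open>m + 1\<close> elements, the size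
    \<open>k\<close> forces \<open>m = k - 1\<close>.\<close>
  also have "\<dots> \<longleftrightarrow> r ! k = 1"
  proof
    assume "r ! k = 1"
    with k show "\<exists>I. I \<subseteq> {0..<n} \<and> card I = k \<and> (\<exists>m. I = {0..m} \<and> r ! Suc m = 1)"
      by (intro exI[of _ "{0..k - 1}"] conjI exI[of _ "k - 1"]) auto
  qed auto
  finally show ?thesis
    using k r path_mat_carrier[of n r] by (auto simp: ppr_term_def)
qed

text \<open>The case \<open>n = 0\<close> is excluded because the empty matrix has no diagonal zero:
  its sequence is \<open>[0]\<close>, so \<open>[1]\<close> would satisfy the right-hand side
  without being realised.\<close>

theorem theorem3p1:
  fixes n :: nat and r :: "nat list"
  assumes "n \<ge> 1"
    and "length r = n + 1"
    and "set r \<subseteq> {0, 1}"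
    and "r \<noteq> [1, 1]"
  shows "(\<exists>A :: real mat. A \<in> carrier_mat n n \<and> nonneg_mat A \<and> ppr_seq A = r) \<longleftrightarrow>
         (r ! 0 = 0 \<and> (\<forall>i\<in>{1..n}. r ! i = 1)) \<or> r ! 0 = 1"
proof -
  have bits: "r ! i \<in> {0, 1}" if "i \<le> n" for i
    using that assms(2,3) by (metis Suc_eq_plus1 le_imp_less_Suc nth_mem subsetD)
  have seq_iff: "ppr_seq A = r \<longleftrightarrow> (\<forall>i\<le>n. ppr_term A i = r ! i)"
    if "A \<in> carrier_mat n n" for A :: "real mat"
    using that assms(2)
    by (auto simp: ppr_seq_def list_eq_iff_nth_eq less_Suc_eq_le simp del: upt_Suc)
  show ?thesis
  proof
    assume "\<exists>A :: real mat. A \<in> carrier_mat n n \<and> nonneg_mat A \<and> ppr_seq A = r"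
    then obtain A :: "real mat" where A: "A \<in> carrier_mat n n" "nonneg_mat A" "ppr_seq A = r"
      by blast
    then have seq: "ppr_term A i = r ! i" if "i \<le> n" for i
      using that by (simp add: seq_iff)
    have "r ! i = 1" if "r ! 0 = 0" "i \<in> {1..n}" for i
    proof -
      have "A $$ (i, i) \<noteq> 0" if "i < n" for i
        using seq[of 0] \<open>r ! 0 = 0\<close> that A(1) by (auto simp: ppr_term_def split: if_splits)
      then show ?thesis
        using ppr_term_eq_1_if_nonzero_diagonal[OF A(1,2) _ that(2)] seq that(2) by auto
    qed
    with bits[of 0] show "(r ! 0 = 0 \<and> (\<forall>i\<in>{1..n}. r ! i = 1)) \<or> r ! 0 = 1"
      by auto
  next
    assume "(r ! 0 = 0 \<and> (\<forall>i\<in>{1..n}. r ! i = 1)) \<or> r ! 0 = 1"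
    then show "\<exists>A :: real mat. A \<in> carrier_mat n n \<and> nonneg_mat A \<and> ppr_seq A = r"
    proof
      assume r: "r ! 0 = 0 \<and> (\<forall>i\<in>{1..n}. r ! i = 1)"
      \<comment> \<open>The identity matrix realises case (i), as its diagonal has no zero.\<close>
      have one: "nonneg_mat (1\<^sub>m n)"
        by (simp add: nonneg_mat_def one_mat_def)
      have "ppr_term (1\<^sub>m n :: real mat) i = r ! i" if "i \<le> n" for i
      proof (cases "i = 0")
        case False
        with that r show ?thesis
          by (simp add: ppr_term_eq_1_if_nonzero_diagonal[OF one_carrier_mat one])
      qed (use r in \<open>simp add: ppr_term_def\<close>)
      with one show ?thesis
        by (intro exI[of _ "1\<^sub>m n"]) (simp add: seq_iff)
    next
      assume r0: "r ! 0 = 1"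
      \<comment> \<open>The last vertex of the path has a loop only if \<open>n = 1\<close> and \<open>r = [1, 1]\<close>.\<close>
      have "n = 1 \<Longrightarrow> r ! 1 \<noteq> 1"
        using assms(2,4) r0 by (auto simp: length_Suc_conv)
      then have "path_mat n r $$ (n - 1, n - 1) = 0"
        using assms(1) by (auto simp: path_mat_def)
      then have "\<exists>i<dim_row (path_mat n r). path_mat n r $$ (i, i) = 0"
        using assms(1) path_mat_carrier[of n r] by (intro exI[of _ "n - 1"]) auto
      then have "ppr_term (path_mat n r) 0 = r ! 0"
        by (simp add: ppr_term_def r0)
      moreover have "ppr_term (path_mat n r) i = r ! i" if "i \<le> n" "i \<noteq> 0" for i
        using that bits by (intro ppr_term_path_mat) auto
      ultimately have "ppr_seq (path_mat n r) = r"
        unfolding seq_iff[OF path_mat_carrier] by metis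
      then show ?thesis
        using path_mat_carrier nonneg_path_mat by blast
    qed
  qed
qed

end
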